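(* Let $f:\mathbb{R}^n\to\mathbb{R}$ and $F:\mathbb{R}^n\to\mathbb{R}^m$ satisfy the local standing assumptions and the global assumptions listed in the context, with $\mathcal{M}=\{x:F(x)=0\}$. There exist constants $K_1,K_2,K_3,K_4$ such that for any $k\ge K_1$, if we take $\varepsilon=K_2/k$, and initialize the SQP iterates on the manifold $\mathcal{M}$ (that is, $x_0\in\mathcal{M}$) with stepsize $\eta=K_3/k^{1/2}$, we have $$\min_{i\in\{1,\dots,k\}}\|\mathrm{grad} f(x_i)\|_2\le K_4/k^{1/4}.$$
   Context: Setting. $m\le n$; $f:\mathbb{R}^n\to\mathbb{R}$ and $F:\mathbb{R}^n\to\mathbb{R}^m$ are $C^2$; $\mathcal{M}=\{x\in\mathbb{R}^n:F(x)=0\}$ and $\mathcal{M}_\varepsilon=\{x\in\mathbb{R}^n:\|F(x)\|_2\le\varepsilon\}$; $x_\star$ is a local minimizer of $f$ on $\mathcal{M}$. The parameter $\varepsilon=K_2/k$ is the radius of the neighborhood $\mathcal{M}_\varepsilon$ of the manifold used in the analysis; it does not enter the conclusion or the iteration other than through the matching stepsize. $k$ is a natural number. $\nabla f(x)\in\mathbb{R}^n$ is the gradient, $\nabla F(x)\in\mathbb{R}^{m\times n}$ the Jacobian, $A^\dagger$ the Moore–Penrose inverse (for $A\in\mathbb{R}^{m\times n}$ of rank $m$, $A^\dagger=A^{\mathsf T}(AA^{\mathsf T})^{-1}$), $A^{\dagger\mathsf T}$ its transpose, $B(x,r)$ the Euclidean ball, $\sigma_{\min}$ the least singular value. Matrices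 and tensors carry operator norms. Local standing assumptions, for some $\delta>0$: (1) On $B(x_\star,\delta)$, $f$ and $F$ are $C^2$ and Lipschitz with constants $L_f,L_F$, have Lipschitz gradients (Jacobians) with constants $\beta_f,\beta_F$, and Lipschitz Hessians with constants $\rho_f,\rho_F$. (2) $\mathcal{M}$ is an $(n-m)$-dimensional smooth submanifold of $\mathbb{R}^n$, and $\inf_{x\in B(x_\star,\delta)}\sigma_{\min}(\nabla F(x))\ge\gamma_F$ for some constant $\gamma_F>0$. (3) With $\mathsf{P}_{x}=I_n-\nabla F(x)^\dagger\nabla F(x)$ and $\mathrm{Hess} f(x_\star)=\mathsf{P}_{x_\star}\nabla^2 f(x_\star)\mathsf{P}_{x_\star}-\sum_{i=1}^m[\nabla F(x_\star)^{\dagger\mathsf T}\nabla f(x_\star)]_i\,\mathsf{P}_{x_\star}\nabla^2F_i(x_\star)\mathsf{P}_{x_\star}$, the supremum $\lambda_{\max}$ and infimum $\lambda_{\min}$ of $\langle u,\mathrm{Hess} f(x_\star)u\rangle$ over $\|u\|_2=1$, $\nabla F(x_\star)u=0$, satisfy $0<\lambda_{\min}\le\lambda_{\max}<\infty$. Global assumptions: (i) There exists $\varepsilon_0>0$ such that $\sup_{x\in\mathcal{M}_{\varepsilon_0}}\|\nabla f(x)\|_2\le G_f$ and $\inf_{x\in\mathcal{M}_{\varepsilon_0}}f(x)\ge\underline f$, for some reals $G_f$ and $\underline f$. (ii) $\inf_{x\in\mathcal{M}_{\varepsilon_0}}\sigma_{\min}(\nabla F(x))\ge\gamma_F$. (iii)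 On all of $\mathbb{R}^n$: $f,F$ are $C^2$, $f$ is $L_f$-Lipschitz, and $\nabla f,\nabla F$ are Lipschitz with constants $\beta_f,\beta_F$. Extended Riemannian gradient: $\mathrm{grad} f(x)=\mathsf{P}_x\nabla f(x)$, for $x$ on or off $\mathcal{M}$. SQP iterates with stepsize $\eta>0$: $x_{j+1}$ is the minimizer of $f(x_j)+\langle\nabla f(x_j),x-x_j\rangle+\frac1{2\eta}\|x-x_j\|_2^2$ over $x$ subject to $F(x_j)+\nabla F(x_j)(x-x_j)=0$. When $\nabla F(x_j)$ has rank $m$ this is $x_{j+1}=x_j-\eta\,\mathrm{grad} f(x_j)-\nabla F(x_j)^\dagger F(x_j)$.
   Formalization: K_4 may depend on an upper bound for f(x_0), uniformly over x_0 in M below that bound; K_1, K_2, K_3 do not depend on x_0. With K_4 uniform over all of M the claim fails, e.g. for F(x,y)=y, f=sqrt(1+x^2), starting far out on M. *)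

theory Defs
  imports "HOL-Analysis.Analysis"
begin

text \<open>On an open set, the following is the usual notion of a k times continuously differentiable
  map between finite-dimensional spaces: in the successor case every directional derivative is
  required to be k times continuously differentiable.\<close>

primrec Ck_on :: "nat \<Rightarrow> ('a::euclidean_space \<Rightarrow> 'b::real_normed_vector) \<Rightarrow> 'a set \<Rightarrow> bool" where
  "Ck_on 0 f S \<longleftrightarrow> continuous_on S f"
| "Ck_on (Suc k) f S \<longleftrightarrow>
     (\<forall>x\<in>S. f differentiable (at x)) \<and> (\<forall>v. Ck_on k (\<lambda>x. frechet_derivative f (at x) v) S)"

definition smooth_on :: "('a::euclidean_space \<Rightarrow> 'b::real_normed_vector) \<Rightarrow> 'a set \<Rightarrow> bool" where
  "smooth_on f S \<longleftrightarrow> (\<forall>k. Ck_on k f S)"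

text \<open>Embedded d-dimensional submanifolds: locally, a smooth diffeomorphism of the ambient space
  straightens the set to a d-dimensional linear subspace.\<close>

definition smooth_submanifold :: "nat \<Rightarrow> 'a::euclidean_space set \<Rightarrow> bool" where
  "smooth_submanifold d M \<longleftrightarrow>
     (\<forall>p\<in>M. \<exists>U V \<phi> \<psi> (E :: 'a set).
        open U \<and> p \<in> U \<and> open V \<and> homeomorphism U V \<phi> \<psi> \<and> smooth_on \<phi> U \<and> smooth_on \<psi> V \<and>
        subspace E \<and> dim E = d \<and> \<phi> ` (M \<inter> U) = V \<inter> E)"

definition gradient :: "('a::real_inner \<Rightarrow> real) \<Rightarrow> 'a \<Rightarrow> 'a" where
  "gradient f x = (THE D. GDERIV f x :> D)"

definition hessian :: "(real^'n \<Rightarrow> real) \<Rightarrow> real^'n \<Rightarrow> real^'n^'n" where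
  "hessian f x = jacobian (gradient f) (at x)"

text \<open>The norm of the type of bounded linear functions is the operator norm, whereas the norm of
  the matrix type itself is the Frobenius norm. All Lipschitz conditions on matrices and tensors are
  therefore stated for the following bounded linear functions.\<close>

definition mat_op :: "real^'n^'m \<Rightarrow> ((real^'n) \<Rightarrow>\<^sub>L (real^'m))" where
  "mat_op A = Blinfun ((*v) A)"

definition hessian_tensor :: "(real^'n \<Rightarrow> real^'m) \<Rightarrow> real^'n \<Rightarrow> ((real^'n) \<Rightarrow>\<^sub>L (real^'n) \<Rightarrow>\<^sub>L (real^'m))" where
  "hessian_tensor F x =
     Blinfun (\<lambda>u. Blinfun (\<lambda>v. \<chi> i. u \<bullet> (hessian (\<lambda>y. F y $ i) x *v v)))"

text \<open>The Moore--Penrose inverse, by the four Penrose conditions.\<close>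

definition pinv :: "real^'n^'m \<Rightarrow> real^'m^'n" where
  "pinv A = (THE X. A ** X ** A = A \<and> X ** A ** X = X \<and>
                    transpose (A ** X) = A ** X \<and> transpose (X ** A) = X ** A)"

text \<open>Requiring unit vectors on both sides yields exactly the min(m,n) singular values of an m by n
  matrix; in particular 0 occurs only if the rank is not full.\<close>

definition singular_values :: "real^'n^'m \<Rightarrow> real set" where
  "singular_values A =
     {\<sigma>. 0 \<le> \<sigma> \<and> (\<exists>u v. norm u = 1 \<and> norm v = 1 \<and> A *v v = \<sigma> *\<^sub>R u \<and> transpose A *v u = \<sigma> *\<^sub>R v)}"

definition \<sigma>min :: "real^'n^'m \<Rightarrow> real" where
  "\<sigma>min A = Inf (singular_values A)"

definition nbhd :: "(real^'n \<Rightarrow> real^'m) \<Rightarrow> real \<Rightarrow> (real^'n) set" where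
  "nbhd F \<epsilon> = {x. norm (F x) \<le> \<epsilon>}"

definition tproj :: "(real^'n \<Rightarrow> real^'m) \<Rightarrow> real^'n \<Rightarrow> real^'n^'n" where
  "tproj F x = mat 1 - pinv (jacobian F (at x)) ** jacobian F (at x)"

definition ext_grad :: "(real^'n \<Rightarrow> real) \<Rightarrow> (real^'n \<Rightarrow> real^'m) \<Rightarrow> real^'n \<Rightarrow> real^'n" where
  "ext_grad f F x = tproj F x *v gradient f x"

definition riem_hess :: "(real^'n \<Rightarrow> real) \<Rightarrow> (real^'n \<Rightarrow> real^'m) \<Rightarrow> real^'n \<Rightarrow> real^'n^'n" where
  "riem_hess f F x =
     tproj F x ** hessian f x ** tproj F x
     - (\<Sum>i\<in>UNIV. ((transpose (pinv (jacobian F (at x))) *v gradient f x) $ i) *\<^sub>R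
           (tproj F x ** hessian (\<lambda>y. F y $ i) x ** tproj F x))"

definition unit_tangents :: "(real^'n \<Rightarrow> real^'m) \<Rightarrow> real^'n \<Rightarrow> (real^'n) set" where
  "unit_tangents F x = {u. norm u = 1 \<and> jacobian F (at x) *v u = 0}"

definition local_minimizer_on :: "('a::metric_space \<Rightarrow> real) \<Rightarrow> 'a set \<Rightarrow> 'a \<Rightarrow> bool" where
  "local_minimizer_on f M x \<longleftrightarrow> x \<in> M \<and> (\<exists>r>0. \<forall>y\<in>M \<inter> ball x r. f x \<le> f y)"

definition sqp_step :: "(real^'n \<Rightarrow> real) \<Rightarrow> (real^'n \<Rightarrow> real^'m) \<Rightarrow> real \<Rightarrow> real^'n \<Rightarrow> real^'n" where
  "sqp_step f F \<eta> x =
     arg_min (\<lambda>y. f x + gradient f x \<bullet> (y - x) + 1 / (2 * \<eta>) * (norm (y - x))\<^sup>2)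
             (\<lambda>y. F x + jacobian F (at x) *v (y - x) = 0)"

definition sqp_iterate ::
  "(real^'n \<Rightarrow> real) \<Rightarrow> (real^'n \<Rightarrow> real^'m) \<Rightarrow> real \<Rightarrow> real^'n \<Rightarrow> nat \<Rightarrow> real^'n" where
  "sqp_iterate f F \<eta> x0 j = (sqp_step f F \<eta> ^^ j) x0"

end

theory Submission
  imports Defs
begin

text \<open>An SQP step moves by the sum of a tangential part, minus \<eta> grad f, and an orthogonal normal part,
  which solves the linearised constraint. By Taylor's formula the new constraint violation is
  therefore quadratic in the step, so starting from F = 0 it stays below a multiple c of \<eta>^2 once \<eta>
  is small; hence the iterates never leave the region where the Jacobian is uniformly of full rank.
  There each step lowers f by at least \<eta>/2 |grad f|^2, up to an error C \<eta>^2 caused by the normal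
  part. Summing over k steps with \<eta> = k^(-1/2) makes the total error bounded, and k \<eta>/2 times the
  least |grad f|^2 is then bounded by a constant.\<close>

section \<open>Least singular value and the norm of the transpose\<close>

lemma quadratic_ge_zero_imp_linear_zero:
  fixes b c :: real
  assumes "\<And>t. 0 \<le> b * t + c * t\<^sup>2"
  shows "b = 0"
proof -
  \<comment> \<open>With \<open>c - e \<le> -1\<close>, the quadratic at \<open>- b / e\<close> is
    at most \<open>- (b / e)\<^sup>2\<close>, so nonnegativity leaves only
    \<open>b = 0\<close>.\<close>
  define e where "e = 1 + \<bar>c\<bar>"
  have e: "e > 0" "c - e \<le> -1" by (auto simp: e_def)
  have "0 \<le> b * (- b / e) + c * (- b / e)\<^sup>2" by (rule assms)
  also have "\<dots> = (b / e)\<^sup>2 * (c - e)"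
    using e(1) by (simp add: field_simps power2_eq_square)
  also have "\<dots> \<le> (b / e)\<^sup>2 * (-1)"
    using e(2) by (intro mult_left_mono) auto
  finally show ?thesis using e(1) by simp
qed

lemma inner_transpose_mult:
  fixes A :: "real^'n^'m"
  shows "(transpose A *v u) \<bullet> v = u \<bullet> (A *v v)"
  by (simp add: dot_lmul_matrix)

text \<open>A minimiser of the norm of the transpose on the unit sphere is a left singular vector.\<close>

lemma sigma_min_le_norm_transpose:
  fixes A :: "real^'n^'m"
  assumes "CARD('m) \<le> CARD('n)" and "0 < \<sigma>min A"
  shows "\<sigma>min A * norm u \<le> norm (transpose A *v u)"
proof -
  let ?T = "\<lambda>u. transpose A *v u"
  have cont: "continuous_on (sphere 0 1) (\<lambda>u. norm (?T u))"
    by (intro continuous_intros linear_continuous_on_compose[where g = ?T, OF _ matrix_vector_mul_linear])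
  have "(axis undefined 1 :: real^'m) \<in> sphere 0 1" by simp
  then obtain u0 where u0: "norm u0 = 1" and min: "\<And>u. norm u = 1 \<Longrightarrow> norm (?T u0) \<le> norm (?T u)"
    using continuous_attains_inf[OF compact_sphere _ cont] by fastforce
  define s where "s = norm (?T u0)"
  have s_le: "s * norm u \<le> norm (?T u)" for u
  proof (cases "u = 0")
    case False
    have "s \<le> norm (?T ((1 / norm u) *\<^sub>R u))"
      unfolding s_def using False by (intro min) simp
    also have "\<dots> = norm (?T u) / norm u" by (simp add: matrix_vector_mult_scaleR)
    finally show ?thesis using False by (simp add: field_simps)
  qed simp
  \<comment> \<open>First-order optimality of \<open>u0\<close>: inserting
    \<open>u0 + t *\<^sub>R w\<close> into the square of \<open>s_le\<close> gives a nonnegative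
    quadratic in t without constant term. Its linear coefficient vanishes for every w, which is the
    eigenvector equation.\<close>
  have eig: "A *v ?T u0 = s\<^sup>2 *\<^sub>R u0"
  proof -
    have "(A *v ?T u0 - s\<^sup>2 *\<^sub>R u0) \<bullet> w = 0" for w
    proof -
      have "0 \<le> (2 * (?T u0 \<bullet> ?T w - s\<^sup>2 * (u0 \<bullet> w))) * t
          + ((norm (?T w))\<^sup>2 - s\<^sup>2 * (norm w)\<^sup>2) * t\<^sup>2" for t
      proof -
        have "(s * norm (u0 + t *\<^sub>R w))\<^sup>2 \<le> (norm (?T (u0 + t *\<^sub>R w)))\<^sup>2"
          by (intro power_mono s_le) (simp add: s_def)
        moreover have "?T (u0 + t *\<^sub>R w) = ?T u0 + t *\<^sub>R ?T w"
          by (simp add: matrix_vector_right_distrib matrix_vector_mult_scaleR)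
        moreover have "?T u0 \<bullet> ?T u0 = s\<^sup>2" "u0 \<bullet> u0 = 1"
          using u0 by (simp_all add: s_def dot_square_norm)
        ultimately show ?thesis
          unfolding power_mult_distrib power2_norm_eq_inner
          by (simp add: inner_add_left inner_add_right inner_commute algebra_simps power2_eq_square)
      qed
      then have "?T u0 \<bullet> ?T w - s\<^sup>2 * (u0 \<bullet> w) = 0"
        using quadratic_ge_zero_imp_linear_zero by force
      then show ?thesis
        using inner_transpose_mult[of A w "?T u0"]
        by (simp add: inner_diff_left inner_diff_right inner_commute del: transpose_matrix_vector)
    qed
    then have "A *v ?T u0 - s\<^sup>2 *\<^sub>R u0 = 0" by (rule inner_eq_zero_iff[THEN iffD1])
    then show ?thesis by simp
  qed
  have "s \<in> singular_values A"
  proof (cases "s = 0")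
    case False
    then have "s > 0" by (simp add: s_def)
    then have "norm ((1 / s) *\<^sub>R ?T u0) = 1" by (simp add: s_def)
    moreover have "A *v ((1 / s) *\<^sub>R ?T u0) = s *\<^sub>R u0"
      using \<open>s > 0\<close> by (simp only: matrix_vector_mult_scaleR eig) (simp add: power2_eq_square)
    moreover have "?T u0 = s *\<^sub>R ((1 / s) *\<^sub>R ?T u0)" using \<open>s > 0\<close> by simp
    ultimately show ?thesis
      unfolding singular_values_def using u0 less_imp_le[OF \<open>s > 0\<close>] by blast
  next
    \<comment> \<open>Division by s is impossible here, so the unit right vector comes from the
      kernel of A instead. Since \<open>u0\<close> is orthogonal to the range, the rank is below m,
      hence below n by the dimension hypothesis, and the kernel is nontrivial.\<close>
    case True
    then have T0: "?T u0 = 0" by (simp add: s_def)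
    have "\<not> surj ((*v) A)"
    proof
      assume "surj ((*v) A)"
      then obtain v where "u0 = A *v v" by blast
      then have "u0 \<bullet> u0 = 0" using T0 by (metis inner_transpose_mult inner_zero_left)
      with u0 show False by simp
    qed
    then have "rank A \<noteq> CARD('m)" using full_rank_surjective[of A] by blast
    then have "rank A \<noteq> CARD('n)" using rank_bound[of A] assms(1) by linarith
    then have "\<not> inj ((*v) A)" using full_rank_injective[of A] by blast
    then obtain v where v: "v \<noteq> 0" "A *v v = 0"
      using linear_injective_0[OF matrix_vector_mul_linear[of A]] by auto
    have "norm ((1 / norm v) *\<^sub>R v) = 1" "A *v ((1 / norm v) *\<^sub>R v) = 0 *\<^sub>R u0"
      using v by (auto simp: matrix_vector_mult_scaleR)
    then show ?thesis
      unfolding singular_values_def True using u0 T0 by fastforce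
  qed
  then have "\<sigma>min A \<le> s"
    unfolding \<sigma>min_def by (intro cInf_lower) (auto simp: singular_values_def intro!: bdd_belowI[of _ 0])
  then show ?thesis
    using s_le[of u] mult_right_mono[of "\<sigma>min A" s "norm u"] by simp
qed

section \<open>The Moore-Penrose inverse at full row rank\<close>

text \<open>A X and A Y are both the orthogonal projection onto the range of A, hence equal;
  likewise X A and Y A for the row space. Then X = X A X = Y A Y = Y. This settles the definite
  description in \<open>pinv\<close>.\<close>

lemma penrose_unique:
  fixes A :: "real^'n^'m"
  assumes "A ** X ** A = A" "X ** A ** X = X" "transpose (A ** X) = A ** X" "transpose (X ** A) = X ** A"
    and "A ** Y ** A = A" "Y ** A ** Y = Y" "transpose (A ** Y) = A ** Y" "transpose (Y ** A) = Y ** A"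
  shows "X = Y"
proof -
  have AX: "A ** X = A ** Y"
  proof -
    have "A ** X = transpose (A ** X)" using assms by simp
    also have "\<dots> = transpose ((A ** Y) ** (A ** X))"
      using assms(5) by (simp add: matrix_mul_assoc)
    also have "\<dots> = (A ** X) ** (A ** Y)"
      using assms(3,7) by (simp add: matrix_transpose_mul)
    also have "\<dots> = A ** Y"
      using assms(1) by (simp add: matrix_mul_assoc)
    finally show ?thesis .
  qed
  have XA: "X ** A = Y ** A"
  proof -
    have "X ** A = transpose (X ** A)" using assms by simp
    also have "\<dots> = transpose ((X ** A) ** (Y ** A))"
      using assms(5) by (metis matrix_mul_assoc)
    also have "\<dots> = (Y ** A) ** (X ** A)"
      using assms(4,8) by (simp add: matrix_transpose_mul)
    also have "\<dots> = Y ** A"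
      using assms(1) by (metis matrix_mul_assoc)
    finally show ?thesis .
  qed
  show ?thesis by (metis AX XA assms(2,6) matrix_mul_assoc)
qed

text \<open>The lower bound on the norm of the transpose makes the Gram matrix of the rows
  injective, hence invertible. The transpose of A times its inverse satisfies the Penrose
  conditions, and uniqueness identifies it with \<open>pinv A\<close>.\<close>

lemma pinv_full_row_rank:
  fixes A :: "real^'n^'m"
  assumes "CARD('m) \<le> CARD('n)" and "0 < \<sigma>min A"
  shows "A ** pinv A = mat 1" and "transpose (pinv A ** A) = pinv A ** A"
    and "pinv A ** A ** pinv A = pinv A"
proof -
  let ?G = "A ** transpose A"
  have "u = 0" if "?G *v u = 0" for u
  proof -
    have "(transpose A *v u) \<bullet> (transpose A *v u) = 0"
      using that by (metis inner_transpose_mult inner_zero_right matrix_vector_mul_assoc)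
    then show ?thesis
      using sigma_min_le_norm_transpose[OF assms, of u] assms(2)
      by (simp add: mult_le_0_iff)
  qed
  then have "inj ((*v) ?G)"
    using linear_injective_0[OF matrix_vector_mul_linear[of ?G]] by blast
  then have "invertible ?G"
    by (simp add: invertible_left_inverse matrix_left_invertible_injective)
  then obtain H where H: "?G ** H = mat 1" "H ** ?G = mat 1"
    unfolding invertible_def by blast
  have symH: "transpose H = H"
  proof -
    have "transpose H ** ?G = mat 1"
      using H(1) by (metis matrix_transpose_mul transpose_mat transpose_transpose)
    then show ?thesis by (metis H(1) matrix_mul_assoc matrix_mul_lid matrix_mul_rid)
  qed
  define X where "X = transpose A ** H"
  have AX: "A ** X = mat 1" by (simp add: X_def matrix_mul_assoc H(1))
  have symXA: "transpose (X ** A) = X ** A"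
    by (simp add: X_def matrix_transpose_mul symH matrix_mul_assoc)
  have XAX: "X ** A ** X = X" by (metis AX matrix_mul_assoc matrix_mul_rid)
  have "pinv A = X"
    unfolding pinv_def
  proof (rule the_equality)
    show X: "A ** X ** A = A \<and> X ** A ** X = X \<and>
        transpose (A ** X) = A ** X \<and> transpose (X ** A) = X ** A"
      by (simp only: AX symXA XAX transpose_mat matrix_mul_lid simp_thms)
    show "Y = X" if "A ** Y ** A = A \<and> Y ** A ** Y = Y \<and>
        transpose (A ** Y) = A ** Y \<and> transpose (Y ** A) = Y ** A" for Y
      using penrose_unique[of A Y X] that X by blast
  qed
  then show "A ** pinv A = mat 1" and "transpose (pinv A ** A) = pinv A ** A"
    and "pinv A ** A ** pinv A = pinv A"
    using AX symXA XAX by simp_all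
qed

text \<open>The vector \<open>pinv A *v b\<close> lies in the row space, so it is the transpose of A
  applied to some u. Its squared norm is then the inner product of u and b, and
  \<open>\<sigma>min A\<close> bounds the norm of u by that of the vector itself; one factor
  cancels.\<close>

lemma norm_pinv_mult_le:
  fixes A :: "real^'n^'m"
  assumes "CARD('m) \<le> CARD('n)" and "0 < \<sigma>min A"
  shows "norm (pinv A *v b) \<le> norm b / \<sigma>min A"
proof (cases "pinv A *v b = 0")
  case False
  let ?X = "pinv A"
  define u where "u = transpose ?X *v (?X *v b)"
  have "transpose A *v u = (transpose (?X ** A)) *v (?X *v b)"
    by (simp only: u_def matrix_transpose_mul matrix_vector_mul_assoc matrix_mul_assoc)
  also have "\<dots> = ?X *v b"
    by (simp only: pinv_full_row_rank[OF assms] matrix_vector_mul_assoc)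
  finally have u: "transpose A *v u = ?X *v b" .
  have "(norm (?X *v b))\<^sup>2 = u \<bullet> (A *v (?X *v b))"
    by (metis u inner_transpose_mult power2_norm_eq_inner)
  also have "\<dots> = u \<bullet> b" by (simp add: matrix_vector_mul_assoc pinv_full_row_rank[OF assms])
  also have "\<dots> \<le> norm u * norm b" by (rule norm_cauchy_schwarz)
  also have "\<sigma>min A * norm u \<le> norm (?X *v b)"
    using sigma_min_le_norm_transpose[OF assms, of u] u by simp
  then have "norm u * norm b \<le> norm (?X *v b) / \<sigma>min A * norm b"
    using assms(2) by (intro mult_right_mono) (auto simp: field_simps)
  finally show ?thesis
    using False by (simp add: power2_eq_square flip: times_divide_eq_right)
qed (use assms in simp)

section \<open>Taylor remainders and gradients\<close>

text \<open>The mean value inequality on the segment is applied to h minus its linearisation at x.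
  This gives the constant L rather than the sharper L/2 of the integral form, which only affects
  constants later.\<close>

lemma lipschitz_derivative_remainder:
  fixes h :: "'a::real_normed_vector \<Rightarrow> 'b::real_normed_vector" and D :: "'a \<Rightarrow> 'a \<Rightarrow>\<^sub>L 'b"
  assumes D: "\<And>x. (h has_derivative D x) (at x)" and L: "L-lipschitz_on UNIV D"
  shows "norm (h y - h x - D x (y - x)) \<le> L * (norm (y - x))\<^sup>2"
proof -
  have "norm (h y - h x - D x (y - x)) \<le> norm (y - x) * (L * norm (y - x))"
  proof (rule differentiable_bound_linearization[where S = "closed_segment x y"])
    fix t :: real assume "t \<in> {0..1}"
    then show "x + t *\<^sub>R (y - x) \<in> closed_segment x y"
      unfolding closed_segment_def
      by (intro CollectI exI[of _ t]) (auto simp: algebra_simps)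
  next
    fix z assume "z \<in> closed_segment x y"
    then have "norm (z - x) \<le> norm (y - x)" by (rule segment_bound)
    have "onorm (blinfun_apply (D z) - blinfun_apply (D x)) = norm (D z - D x)"
      by (simp add: norm_blinfun.rep_eq minus_blinfun.rep_eq fun_diff_def)
    also have "\<dots> \<le> L * norm (z - x)"
      using lipschitz_onD[OF L, of z x] by (simp add: dist_norm)
    also have "\<dots> \<le> L * norm (y - x)"
      using \<open>norm (z - x) \<le> _\<close> lipschitz_on_nonneg[OF L] by (rule mult_left_mono)
    finally show "onorm (blinfun_apply (D z) - blinfun_apply (D x)) \<le> L * norm (y - x)" .
  qed (auto intro: has_derivative_at_withinI D)
  then show ?thesis by (simp add: power2_eq_square mult_ac)
qed

lemma mat_op_apply: "blinfun_apply (mat_op A) = (*v) A"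
  unfolding mat_op_def by (rule bounded_linear_Blinfun_apply) (rule matrix_vector_mul_bounded_linear)

text \<open>Settles the definite description in \<open>gradient\<close>: the representing vector is
  the adjoint of the derivative applied to 1, and uniqueness of derivatives makes it unique.\<close>

lemma has_derivative_gradient:
  fixes f :: "'a::euclidean_space \<Rightarrow> real"
  assumes "f differentiable (at x)"
  shows "(f has_derivative (\<lambda>v. gradient f x \<bullet> v)) (at x)"
proof -
  obtain f' where f': "(f has_derivative f') (at x)"
    using assms by (auto simp: differentiable_def)
  have lin: "linear f'" using f' by (rule has_derivative_linear)
  define D where "D = adjoint f' 1"
  have "f' v = v \<bullet> D" for v
    using adjoint_works[OF lin, of v 1] by (simp add: D_def)
  then have GD: "GDERIV f x :> D"
    using f' by (simp add: gderiv_def ext[of f' "\<lambda>v. v \<bullet> D"])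
  moreover have "D' = D" if "GDERIV f x :> D'" for D'
  proof -
    have "(\<lambda>v. v \<bullet> D') = (\<lambda>v. v \<bullet> D)"
      using that GD unfolding gderiv_def by (rule has_derivative_unique)
    then show ?thesis by (metis inner_commute vector_eq_ldot)
  qed
  ultimately have "gradient f x = D"
    unfolding gradient_def by (rule the_equality)
  with GD show ?thesis by (simp add: gderiv_def inner_commute)
qed

section \<open>Closed form of the SQP step\<close>

text \<open>As \<open>pinv A ** A\<close> is symmetric and fixes the range of \<open>pinv A\<close>,
  that range is orthogonal to the kernel of A. The gradient and its tangential part differ by a
  vector of this range, so they have the same inner products with tangent vectors.\<close>

lemma ext_grad_orthogonal:
  fixes F :: "real^'n \<Rightarrow> real^'m"
  assumes "CARD('m) \<le> CARD('n)" and "0 < \<sigma>min (jacobian F (at x))"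
  shows "jacobian F (at x) *v ext_grad f F x = 0"
    and "jacobian F (at x) *v w = 0 \<Longrightarrow> w \<bullet> (pinv (jacobian F (at x)) *v b) = 0"
    and "jacobian F (at x) *v w = 0 \<Longrightarrow> w \<bullet> ext_grad f F x = w \<bullet> gradient f x"
proof -
  let ?A = "jacobian F (at x)"
  note pinv = pinv_full_row_rank[OF assms]
  have eg: "ext_grad f F x = gradient f x - pinv ?A *v (?A *v gradient f x)"
    by (simp add: ext_grad_def tproj_def matrix_vector_mult_diff_rdistrib matrix_vector_mul_assoc)
  show "?A *v ext_grad f F x = 0"
    unfolding eg matrix_vector_mult_diff_distrib matrix_vector_mul_assoc pinv(1)
    by (simp add: matrix_mul_assoc pinv(1))
  show orth: "w \<bullet> (pinv ?A *v b) = 0" if "?A *v w = 0" for w b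
  proof -
    have "pinv ?A *v b = transpose (pinv ?A ** ?A) *v (pinv ?A *v b)"
      by (simp only: pinv matrix_vector_mul_assoc)
    then have "w \<bullet> (pinv ?A *v b) = (pinv ?A *v b) \<bullet> ((pinv ?A ** ?A) *v w)"
      by (metis inner_commute inner_transpose_mult)
    also have "(pinv ?A ** ?A) *v w = 0"
      using that by (metis matrix_vector_mul_assoc matrix_vector_mult_0_right)
    finally show ?thesis by simp
  qed
  show "w \<bullet> ext_grad f F x = w \<bullet> gradient f x" if "?A *v w = 0"
    by (simp add: eg inner_diff_right orth[OF that])
qed

lemma sqp_step_eq:
  fixes F :: "real^'n \<Rightarrow> real^'m"
  assumes "CARD('m) \<le> CARD('n)" and "0 < \<sigma>min (jacobian F (at x))" and "\<eta> > 0"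
  shows "sqp_step f F \<eta> x = x - (\<eta> *\<^sub>R ext_grad f F x + pinv (jacobian F (at x)) *v F x)"
proof -
  let ?A = "jacobian F (at x)"
  let ?P = "\<lambda>y. F x + ?A *v (y - x) = 0"
  let ?q = "\<lambda>y. f x + gradient f x \<bullet> (y - x) + 1 / (2 * \<eta>) * (norm (y - x))\<^sup>2"
  note orth = ext_grad_orthogonal[OF assms(1,2)]
  define d where "d = - (\<eta> *\<^sub>R ext_grad f F x + pinv ?A *v F x)"
  have Ad: "F x + ?A *v d = 0"
    using orth(1)[of f] pinv_full_row_rank(1)[OF assms(1,2)]
    by (simp add: d_def matrix_vector_mult_diff_distrib matrix_vector_mult_scaleR
        matrix_vector_mul_assoc vec.neg matrix_vector_right_distrib)
  \<comment> \<open>Completing the square: feasible points differ from \<open>x + d\<close> by a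
    kernel vector w, for which the linear terms of the objective cancel.\<close>
  have gap: "?q y = ?q (x + d) + (norm (y - (x + d)))\<^sup>2 / (2 * \<eta>)" if "?P y" for y
  proof -
    define w where "w = y - (x + d)"
    have yx: "y - x = d + w" by (simp add: w_def)
    have "?A *v w = 0"
      using that Ad by (metis yx matrix_vector_right_distrib add.assoc add_0)
    then have "w \<bullet> d = - \<eta> * (w \<bullet> gradient f x)"
      using orth(2,3) by (simp add: d_def inner_diff_right inner_add_right)
    then have "(norm (d + w))\<^sup>2 = (norm d)\<^sup>2 - 2 * \<eta> * (gradient f x \<bullet> w) + (norm w)\<^sup>2"
      by (simp add: power2_norm_eq_inner inner_add_left inner_add_right inner_commute)
    then have "1 / (2 * \<eta>) * (norm (d + w))\<^sup>2
        = 1 / (2 * \<eta>) * (norm d)\<^sup>2 - gradient f x \<bullet> w + (norm w)\<^sup>2 / (2 * \<eta>)"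
      using assms(3) by (simp add: field_simps)
    then show ?thesis
      unfolding yx w_def[symmetric] by (simp add: inner_add_right)
  qed
  have "arg_min ?q ?P = x + d"
  proof (rule arg_minI)
    show "?P (x + d)" using Ad by simp
    show "\<not> ?q y < ?q (x + d)" if "?P y" for y
      unfolding gap[OF that] using assms(3) by (simp add: not_less)
    \<comment> \<open>\<open>arg_min\<close> merely chooses some minimiser, so uniqueness is what
      determines its value.\<close>
    show "y = x + d" if "?P y" "\<forall>z. ?P z \<longrightarrow> \<not> ?q z < ?q y" for y
    proof -
      have "\<not> ?q (x + d) < ?q y" using that(2) Ad by (metis add_diff_cancel_left')
      then have "(norm (y - (x + d)))\<^sup>2 / (2 * \<eta>) \<le> 0"
        using gap[OF that(1)] by linarith
      then show ?thesis using assms(3) by (simp add: divide_le_0_iff)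
    qed
  qed
  then show ?thesis by (simp add: sqp_step_def d_def)
qed

text \<open>Carries the Lipschitz condition from gradient vectors to derivatives in operator norm,
  the form taken by \<open>lipschitz_derivative_remainder\<close>.\<close>

lemma lipschitz_on_blinfun_inner_right:
  assumes "L-lipschitz_on S g"
  shows "L-lipschitz_on S (\<lambda>x. blinfun_inner_right (g x))"
proof (rule lipschitz_onI)
  fix x y assume xy: "x \<in> S" "y \<in> S"
  have "norm (blinfun_inner_right (g x) - blinfun_inner_right (g y)) \<le> norm (g x - g y)"
    by (rule norm_blinfun_bound)
      (simp_all add: minus_blinfun.rep_eq Cauchy_Schwarz_ineq2 flip: inner_diff_left)
  also have "\<dots> \<le> L * dist x y"
    using lipschitz_onD[OF assms xy] by (simp add: dist_norm)
  finally show "dist (blinfun_inner_right (g x)) (blinfun_inner_right (g y)) \<le> L * dist x y"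
    by (simp add: dist_norm)
qed (rule lipschitz_on_nonneg[OF assms])

lemma has_derivative_mat_op_jacobian:
  assumes "F differentiable (at x)"
  shows "(F has_derivative mat_op (jacobian F (at x))) (at x)"
  using assms by (simp add: mat_op_apply jacobian_works)

section \<open>Feasibility and descent along the iterates\<close>

locale sqp =
  fixes f :: "real^'n \<Rightarrow> real" and F :: "real^'n \<Rightarrow> real^'m" and \<epsilon>0 \<beta>f \<beta>F \<gamma> G :: real
  assumes dims: "CARD('m) \<le> CARD('n)"
    and f_diff: "\<And>x. f differentiable (at x)" and F_diff: "\<And>x. F differentiable (at x)"
    and f_lip: "\<beta>f-lipschitz_on UNIV (gradient f)"
    and F_lip: "\<beta>F-lipschitz_on UNIV (\<lambda>x. mat_op (jacobian F (at x)))"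
    and \<gamma>_pos: "0 < \<gamma>"
    and grad_le: "\<And>x. x \<in> nbhd F \<epsilon>0 \<Longrightarrow> norm (gradient f x) \<le> G"
    and \<sigma>min_ge: "\<And>x. x \<in> nbhd F \<epsilon>0 \<Longrightarrow> \<gamma> \<le> \<sigma>min (jacobian F (at x))"
begin

text \<open>The tangential part p and the normal part q of the step are orthogonal, so its squared
  length splits. The linearised constraint vanishes at the new point, leaving only the remainder of
  F. The descent bound keeps the norm of p instead of replacing it by G, so that it can later be
  absorbed.\<close>

lemma sqp_step_estimates:
  assumes x: "x \<in> nbhd F \<epsilon>0" and \<eta>: "0 < \<eta>"
  shows "norm (F (sqp_step f F \<eta> x)) \<le> \<beta>F * (\<eta>\<^sup>2 * G\<^sup>2 + (norm (F x) / \<gamma>)\<^sup>2)" (is ?feas)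
    and "f (sqp_step f F \<eta> x) \<le> f x - \<eta> * (norm (ext_grad f F x))\<^sup>2 + G * (norm (F x) / \<gamma>)
           + \<beta>f * (\<eta>\<^sup>2 * (norm (ext_grad f F x))\<^sup>2 + (norm (F x) / \<gamma>)\<^sup>2)" (is ?desc)
proof -
  let ?A = "jacobian F (at x)" and ?y = "sqp_step f F \<eta> x"
  define g where "g = gradient f x"
  define p where "p = ext_grad f F x"
  define q where "q = pinv ?A *v F x"
  have \<sigma>: "0 < \<sigma>min ?A" using \<sigma>min_ge[OF x] \<gamma>_pos by linarith
  note orth = ext_grad_orthogonal[OF dims \<sigma>]
  have g_le: "norm g \<le> G" unfolding g_def by (rule grad_le[OF x])
  have q_le: "norm q \<le> norm (F x) / \<gamma>"
  proof -
    have "norm q \<le> norm (F x) / \<sigma>min ?A"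
      unfolding q_def by (rule norm_pinv_mult_le[OF dims \<sigma>])
    also have "\<dots> \<le> norm (F x) / \<gamma>"
      using \<sigma>min_ge[OF x] \<gamma>_pos by (intro divide_left_mono) auto
    finally show ?thesis .
  qed
  have pq: "p \<bullet> q = 0" and gp: "g \<bullet> p = (norm p)\<^sup>2"
    using orth(2)[OF orth(1)] orth(3)[OF orth(1)]
    by (simp_all add: p_def q_def g_def inner_commute power2_norm_eq_inner)
  have p_le: "norm p \<le> G"
  proof (cases "p = 0")
    case False
    have "norm p * norm p \<le> norm g * norm p"
      using gp norm_cauchy_schwarz[of g p] by (simp add: power2_eq_square)
    with False g_le show ?thesis by simp
  qed (use g_le order_trans[OF norm_ge_zero g_le] in simp)
  have step: "?y - x = - (\<eta> *\<^sub>R p + q)"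
    unfolding sqp_step_eq[OF dims \<sigma> \<eta>] p_def q_def by simp
  have norm_step: "(norm (?y - x))\<^sup>2 = \<eta>\<^sup>2 * (norm p)\<^sup>2 + (norm q)\<^sup>2"
    unfolding step norm_minus_cancel power2_norm_eq_inner
    using pq by (simp add: inner_add_left inner_add_right inner_commute power2_eq_square)
  have q2: "(norm q)\<^sup>2 \<le> (norm (F x) / \<gamma>)\<^sup>2"
    using q_le by (intro power_mono) auto
  have p2: "(norm p)\<^sup>2 \<le> G\<^sup>2"
    using p_le by (intro power_mono) auto
  have Jstep: "F x + ?A *v (?y - x) = 0"
    using orth(1)[of f] pinv_full_row_rank(1)[OF dims \<sigma>]
    by (simp add: step p_def q_def matrix_vector_mult_diff_distrib matrix_vector_mult_scaleR
        matrix_vector_mul_assoc vec.neg)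
  have "norm (F ?y - F x - mat_op ?A (?y - x)) \<le> \<beta>F * (norm (?y - x))\<^sup>2"
    by (rule lipschitz_derivative_remainder[OF has_derivative_mat_op_jacobian[OF F_diff] F_lip])
  then have "norm (F ?y) \<le> \<beta>F * (norm (?y - x))\<^sup>2"
    using Jstep by (simp add: mat_op_apply diff_diff_eq)
  also have "\<dots> \<le> \<beta>F * (\<eta>\<^sup>2 * G\<^sup>2 + (norm (F x) / \<gamma>)\<^sup>2)"
    unfolding norm_step using p2 q2 lipschitz_on_nonneg[OF F_lip]
    by (intro mult_left_mono add_mono) auto
  finally show ?feas .
  have "norm (f ?y - f x - blinfun_inner_right (gradient f x) (?y - x)) \<le> \<beta>f * (norm (?y - x))\<^sup>2"
    by (rule lipschitz_derivative_remainder[OF _ lipschitz_on_blinfun_inner_right[OF f_lip]])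
      (simp add: has_derivative_gradient[OF f_diff])
  then have "f ?y \<le> f x + g \<bullet> (?y - x) + \<beta>f * (norm (?y - x))\<^sup>2"
    unfolding g_def real_norm_def by (simp add: abs_le_iff)
  also have "g \<bullet> (?y - x) = - \<eta> * (norm p)\<^sup>2 - g \<bullet> q"
    unfolding step by (simp add: inner_add_right inner_diff_right gp)
  also have "- (g \<bullet> q) \<le> G * (norm (F x) / \<gamma>)"
  proof -
    have "- (g \<bullet> q) \<le> norm g * norm q"
      using norm_cauchy_schwarz[of "- g" q] by simp
    also have "\<dots> \<le> G * (norm (F x) / \<gamma>)"
      using g_le q_le order_trans[OF norm_ge_zero g_le] by (intro mult_mono) auto
    finally show ?thesis .
  qed
  then have "f x + (- \<eta> * (norm p)\<^sup>2 - g \<bullet> q) + \<beta>f * (norm (?y - x))\<^sup>2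
      \<le> f x - \<eta> * (norm p)\<^sup>2 + G * (norm (F x) / \<gamma>) + \<beta>f * (norm (?y - x))\<^sup>2"
    by simp
  also have "\<beta>f * (norm (?y - x))\<^sup>2 \<le> \<beta>f * (\<eta>\<^sup>2 * (norm p)\<^sup>2 + (norm (F x) / \<gamma>)\<^sup>2)"
    unfolding norm_step using q2 lipschitz_on_nonneg[OF f_lip]
    by (intro mult_left_mono add_mono) auto
  finally show ?desc by (simp add: p_def)
qed

text \<open>The tangential part of one step adds at most
  \<open>\<beta>F * G\<^sup>2 * \<eta>\<^sup>2\<close> to the violation. The factor 2 leaves an
  equal share for the violation carried over from the previous iterate.\<close>

definition c :: real where "c = 2 * \<beta>F * G\<^sup>2"

text \<open>Per-step loss in units of \<open>\<eta>\<^sup>2\<close>: the first summand is the linear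
  effect of the normal part on f, the second its quadratic effect.\<close>

definition C :: real where "C = G * c / \<gamma> + \<beta>f * c\<^sup>2 / \<gamma>\<^sup>2"

lemma c_nonneg: "0 \<le> c"
  unfolding c_def using lipschitz_on_nonneg[OF F_lip] by simp

text \<open>The first condition in \<open>step_feas\<close> makes the feasibility bound reproduce
  itself, the second keeps the iterates in the neighbourhood, and \<open>step_desc\<close> lets half
  of the first-order decrease absorb the curvature term.\<close>

context
  fixes \<eta> :: real and x0 :: "real^'n"
  assumes \<eta>: "0 < \<eta>" "\<eta> \<le> 1"
    and step_feas: "2 * \<beta>F * c * \<eta>\<^sup>2 \<le> \<gamma>\<^sup>2" "c * \<eta>\<^sup>2 \<le> \<epsilon>0"
    and step_desc: "2 * \<beta>f * \<eta> \<le> 1"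
    and x0: "F x0 = 0"
begin

abbreviation x :: "nat \<Rightarrow> real^'n" where "x j \<equiv> sqp_iterate f F \<eta> x0 j"

lemma feasibility: "norm (F (x j)) \<le> c * \<eta>\<^sup>2"
proof (induction j)
  case 0
  show ?case using c_nonneg by (simp add: sqp_iterate_def x0)
next
  case (Suc j)
  have in_nbhd: "x j \<in> nbhd F \<epsilon>0"
    using Suc step_feas(2) by (simp add: nbhd_def)
  have "norm (F (x (Suc j))) \<le> \<beta>F * (\<eta>\<^sup>2 * G\<^sup>2 + (norm (F (x j)) / \<gamma>)\<^sup>2)"
    using sqp_step_estimates(1)[OF in_nbhd \<eta>(1)] by (simp add: sqp_iterate_def)
  also have "\<dots> \<le> \<beta>F * (\<eta>\<^sup>2 * G\<^sup>2 + (c * \<eta>\<^sup>2 / \<gamma>)\<^sup>2)"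
    using Suc \<gamma>_pos lipschitz_on_nonneg[OF F_lip]
    by (intro mult_left_mono add_left_mono power_mono divide_right_mono) auto
  \<comment> \<open>The carried-over term is factored so that the first condition of
    \<open>step_feas\<close> bounds it by the other half of the target.\<close>
  also have "\<dots> = c * \<eta>\<^sup>2 / 2 + (2 * \<beta>F * c * \<eta>\<^sup>2) * (c * \<eta>\<^sup>2 / (2 * \<gamma>\<^sup>2))"
    by (simp add: c_def power2_eq_square field_simps)
  also have "(2 * \<beta>F * c * \<eta>\<^sup>2) * (c * \<eta>\<^sup>2 / (2 * \<gamma>\<^sup>2)) \<le> \<gamma>\<^sup>2 * (c * \<eta>\<^sup>2 / (2 * \<gamma>\<^sup>2))"
    using step_feas(1) c_nonneg by (intro mult_right_mono) auto
  also have "c * \<eta>\<^sup>2 / 2 + \<gamma>\<^sup>2 * (c * \<eta>\<^sup>2 / (2 * \<gamma>\<^sup>2)) = c * \<eta>\<^sup>2"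
    using \<gamma>_pos by simp
  finally show ?case by simp
qed

lemma iterate_in_nbhd: "x j \<in> nbhd F \<epsilon>0"
  using feasibility[of j] step_feas(2) by (simp add: nbhd_def)

lemma descent: "f (x (Suc j)) \<le> f (x j) - \<eta> / 2 * (norm (ext_grad f F (x j)))\<^sup>2 + C * \<eta>\<^sup>2"
proof -
  define a where "a = (norm (ext_grad f F (x j)))\<^sup>2"
  have G: "0 \<le> G" using grad_le[OF iterate_in_nbhd[of 0]] norm_ge_zero order_trans by blast
  have \<beta>f: "0 \<le> \<beta>f" by (rule lipschitz_on_nonneg[OF f_lip])
  have "f (x (Suc j)) \<le> f (x j) - \<eta> * a + G * (norm (F (x j)) / \<gamma>)
      + \<beta>f * (\<eta>\<^sup>2 * a + (norm (F (x j)) / \<gamma>)\<^sup>2)"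
    using sqp_step_estimates(2)[OF iterate_in_nbhd \<eta>(1)] by (simp add: sqp_iterate_def a_def)
  also have "\<dots> \<le> f (x j) - \<eta> * a + G * (c * \<eta>\<^sup>2 / \<gamma>) + \<beta>f * (\<eta>\<^sup>2 * a + (c * \<eta>\<^sup>2 / \<gamma>)\<^sup>2)"
    using feasibility[of j] \<gamma>_pos G \<beta>f
    by (intro add_mono mult_left_mono power_mono divide_right_mono) auto
  \<comment> \<open>The tangential curvature term is isolated for \<open>step_desc\<close>; the
    normal one is of fourth order in \<eta> and is reduced to second order by \<eta> \<le>
    1.\<close>
  also have "\<dots> = f (x j) - \<eta> * a + (2 * \<beta>f * \<eta>) * (\<eta> / 2 * a)
      + (G * c / \<gamma> + \<beta>f * c\<^sup>2 / \<gamma>\<^sup>2 * \<eta>\<^sup>2) * \<eta>\<^sup>2"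
    by (simp add: power2_eq_square field_simps)
  also have "\<dots> \<le> f (x j) - \<eta> * a + 1 * (\<eta> / 2 * a) + C * \<eta>\<^sup>2"
  proof (intro add_mono mult_right_mono order_refl step_desc)
    have "\<eta>\<^sup>2 \<le> 1" using \<eta> by (simp add: power_le_one)
    then have "\<beta>f * c\<^sup>2 / \<gamma>\<^sup>2 * \<eta>\<^sup>2 \<le> \<beta>f * c\<^sup>2 / \<gamma>\<^sup>2"
      using \<beta>f by (intro mult_left_le) auto
    then show "G * c / \<gamma> + \<beta>f * c\<^sup>2 / \<gamma>\<^sup>2 * \<eta>\<^sup>2 \<le> C" by (simp add: C_def)
  qed (use \<eta> in \<open>simp_all add: a_def\<close>)
  finally show ?thesis by (simp add: a_def)
qed

lemma descent_sum:
  "f (x N) + \<eta> / 2 * (\<Sum>i<N. (norm (ext_grad f F (x i)))\<^sup>2) \<le> f x0 + real N * C * \<eta>\<^sup>2"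
proof (induction N)
  case (Suc N)
  then show ?case using descent[of N] by (simp add: algebra_simps)
qed (simp add: sqp_iterate_def)

end

end

(* The constants do not depend on k or on the initial point, except that K4 depends on an a priori
   upper bound fbar of f at the initial point. Some dependence of this kind is unavoidable when f is
   unbounded on M. If m = n there are no unit tangent vectors, and the condition on the Riemannian
   Hessian is read as void. *)

theorem corollary1:
  fixes f :: "real^'n \<Rightarrow> real" and F :: "real^'n \<Rightarrow> real^'m"
    and xs :: "real^'n" and M :: "(real^'n) set"
    and \<delta> \<epsilon>0 Lf LF \<beta>f \<beta>F \<rho>f \<rho>F \<gamma>F Gf flow :: real
    and lmin lmax :: ereal
  assumes dims: "CARD('m) \<le> CARD('n)"
    and M: "M = {x. F x = 0}"
    and xs: "local_minimizer_on f M xs"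
    \<comment> \<open>local assumptions\<close>
    and "\<delta> > 0"
    and "Ck_on 2 f (ball xs \<delta>)" and "Ck_on 2 F (ball xs \<delta>)"
    and "Lf-lipschitz_on (ball xs \<delta>) f"
    and "LF-lipschitz_on (ball xs \<delta>) F"
    and "\<beta>f-lipschitz_on (ball xs \<delta>) (gradient f)"
    and "\<beta>F-lipschitz_on (ball xs \<delta>) (\<lambda>x. mat_op (jacobian F (at x)))"
    and "\<rho>f-lipschitz_on (ball xs \<delta>) (\<lambda>x. mat_op (hessian f x))"
    and "\<rho>F-lipschitz_on (ball xs \<delta>) (hessian_tensor F)"
    and "smooth_submanifold (CARD('n) - CARD('m)) M"
    and "\<gamma>F > 0"
    and "\<forall>x\<in>ball xs \<delta>. \<sigma>min (jacobian F (at x)) \<ge> \<gamma>F"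
    and "lmin = (INF u\<in>unit_tangents F xs. ereal (u \<bullet> (riem_hess f F xs *v u)))"
    and "lmax = (SUP u\<in>unit_tangents F xs. ereal (u \<bullet> (riem_hess f F xs *v u)))"
    and "unit_tangents F xs \<noteq> {} \<longrightarrow> 0 < lmin \<and> lmin \<le> lmax \<and> lmax < \<infinity>"
    \<comment> \<open>global assumptions\<close>
    and "\<epsilon>0 > 0"
    and "\<forall>x\<in>nbhd F \<epsilon>0. norm (gradient f x) \<le> Gf"
    and "\<forall>x\<in>nbhd F \<epsilon>0. f x \<ge> flow"
    and "\<forall>x\<in>nbhd F \<epsilon>0. \<sigma>min (jacobian F (at x)) \<ge> \<gamma>F"
    and "Ck_on 2 f UNIV" and "Ck_on 2 F UNIV"
    and "Lf-lipschitz_on UNIV f"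
    and "\<beta>f-lipschitz_on UNIV (gradient f)"
    and "\<beta>F-lipschitz_on UNIV (\<lambda>x. mat_op (jacobian F (at x)))"
  shows "\<exists>K1>0. \<exists>K2>0. \<exists>K3>0. \<forall>fbar::real. \<exists>K4>0. \<forall>k::nat. real k \<ge> K1 \<longrightarrow>
           (\<forall>\<epsilon> \<eta> x0. \<epsilon> = K2 / real k \<longrightarrow> \<eta> = K3 / real k powr (1/2) \<longrightarrow> x0 \<in> M \<longrightarrow> f x0 \<le> fbar \<longrightarrow>
              Min ((\<lambda>i. norm (ext_grad f F (sqp_iterate f F \<eta> x0 i))) ` {1..k})
                \<le> K4 / real k powr (1/4))"
proof -
  have Ck: "f differentiable (at x)" "F differentiable (at x)" for x
    using \<open>Ck_on 2 f UNIV\<close> \<open>Ck_on 2 F UNIV\<close> by (simp_all add: numeral_2_eq_2)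
  interpret sqp f F \<epsilon>0 \<beta>f \<beta>F \<gamma>F Gf
    by unfold_locales (use assms Ck in auto)
  have \<beta>: "0 \<le> \<beta>f" "0 \<le> \<beta>F"
    using lipschitz_on_nonneg[OF f_lip] lipschitz_on_nonneg[OF F_lip] by auto
  \<comment> \<open>A point of the neighbourhood is required to deduce that \<open>Gf\<close> is
    nonnegative.\<close>
  have "xs \<in> nbhd F \<epsilon>0"
    using xs M \<open>\<epsilon>0 > 0\<close> by (simp add: local_minimizer_on_def nbhd_def)
  then have "0 \<le> Gf" using grad_le norm_ge_zero order_trans by blast
  then have C: "0 \<le> C"
    unfolding C_def using \<beta> c_nonneg \<gamma>_pos by simp
  \<comment> \<open>Each summand secures one step size condition for \<eta> = k^(-1/2): the 1 gives
    \<eta> \<le> 1, the next two give \<open>step_feas\<close>, and the last gives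
    \<open>step_desc\<close> after a square root.\<close>
  define K1 where "K1 = 1 + 2 * \<beta>F * c / \<gamma>F\<^sup>2 + c / \<epsilon>0 + 4 * \<beta>f\<^sup>2"
  have K1_terms: "0 \<le> 2 * \<beta>F * c / \<gamma>F\<^sup>2" "0 \<le> c / \<epsilon>0" "0 \<le> 4 * \<beta>f\<^sup>2"
    using \<beta> c_nonneg \<open>\<epsilon>0 > 0\<close> by auto
  \<comment> \<open>The absolute value and the summand 1 keep this positive for every
    \<open>fbar\<close>, even below \<open>flow\<close>.\<close>
  define K4 where "K4 fbar = 1 + sqrt (2 * \<bar>fbar - flow + 2 * C\<bar>)" for fbar
  have main: "Min ((\<lambda>i. norm (ext_grad f F (sqp_iterate f F \<eta> x0 i))) ` {1..k})
                \<le> K4 fbar / real k powr (1/4)"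
    if k: "real k \<ge> K1" and \<eta>_def: "\<eta> = 1 / real k powr (1/2)" and x0: "x0 \<in> M" "f x0 \<le> fbar"
    for fbar \<eta> :: real and k :: nat and x0
  proof -
    have k_ge: "real k \<ge> 1" "real k \<ge> 2 * \<beta>F * c / \<gamma>F\<^sup>2" "real k \<ge> c / \<epsilon>0" "real k \<ge> 4 * \<beta>f\<^sup>2"
      using k K1_terms unfolding K1_def by linarith+
    have \<eta>_sqrt: "\<eta> = 1 / sqrt (real k)" using k_ge(1) by (simp add: \<eta>_def powr_half_sqrt)
    have \<eta>2: "\<eta>\<^sup>2 = 1 / real k" by (simp add: \<eta>_sqrt power_divide)
    have \<eta>: "0 < \<eta>" "\<eta> \<le> 1" using k_ge(1) by (simp_all add: \<eta>_sqrt)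
    have "2 * \<beta>f = sqrt (4 * \<beta>f\<^sup>2)" using \<beta> by (simp add: real_sqrt_mult)
    also have "\<dots> \<le> sqrt (real k)" using k_ge(4) by simp
    finally have step_desc: "2 * \<beta>f * \<eta> \<le> 1" using k_ge(1) by (simp add: \<eta>_sqrt)
    have step_feas: "2 * \<beta>F * c * \<eta>\<^sup>2 \<le> \<gamma>F\<^sup>2" "c * \<eta>\<^sup>2 \<le> \<epsilon>0"
      using k_ge \<gamma>_pos \<open>\<epsilon>0 > 0\<close> by (simp_all add: \<eta>2 field_simps)
    have "F x0 = 0" using x0 M by simp
    \<comment> \<open>The descent sum runs over 0, ..., k, so \<open>Suc k\<close> steps are taken
      to reach index k. The accumulated error is (k + 1) C / k, at most 2 C.\<close>
    note it = iterate_in_nbhd[OF \<eta> step_feas step_desc this]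
      and sum = descent_sum[OF \<eta> step_feas step_desc this, of "Suc k"]
    let ?a = "\<lambda>i. norm (ext_grad f F (sqp_iterate f F \<eta> x0 i))"
    define m where "m = Min (?a ` {1..k})"
    have "{1..k} \<noteq> {}" using k_ge(1) by auto
    then have m_le: "m \<le> ?a i" if "i \<in> {1..k}" for i
      unfolding m_def using that by (intro Min_le) auto
    have "m \<in> ?a ` {1..k}"
      unfolding m_def using \<open>{1..k} \<noteq> {}\<close> by (intro Min_in) auto
    then have m_nonneg: "0 \<le> m" by auto
    have "real k * m\<^sup>2 = (\<Sum>i\<in>{1..k}. m\<^sup>2)" by simp
    also have "\<dots> \<le> (\<Sum>i\<in>{1..k}. (?a i)\<^sup>2)"
      using m_nonneg by (intro sum_mono power_mono m_le) auto
    also have "\<dots> \<le> (\<Sum>i<Suc k. (?a i)\<^sup>2)"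
      by (intro sum_mono2) auto
    finally have "\<eta> / 2 * (real k * m\<^sup>2) \<le> \<eta> / 2 * (\<Sum>i<Suc k. (?a i)\<^sup>2)"
      using \<eta> by (intro mult_left_mono) auto
    also have "\<dots> \<le> f x0 + real (Suc k) * C * \<eta>\<^sup>2 - f (sqp_iterate f F \<eta> x0 (Suc k))"
      using sum by linarith
    also have "\<dots> \<le> fbar + 2 * C - flow"
    proof -
      have "real (Suc k) * \<eta>\<^sup>2 \<le> 2" using k_ge(1) by (simp add: \<eta>2 field_simps)
      then have "real (Suc k) * C * \<eta>\<^sup>2 \<le> 2 * C"
        using C mult_right_mono[of "real (Suc k) * \<eta>\<^sup>2" 2 C] by (simp add: mult_ac)
      moreover have "flow \<le> f (sqp_iterate f F \<eta> x0 (Suc k))"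
        using \<open>\<forall>x\<in>nbhd F \<epsilon>0. f x \<ge> flow\<close> it by blast
      ultimately show ?thesis using x0(2) by linarith
    qed
    finally have "\<eta> * real k * m\<^sup>2 \<le> 2 * (fbar - flow + 2 * C)" by (simp add: mult.assoc)
    also have "\<dots> \<le> 2 * \<bar>fbar - flow + 2 * C\<bar>"
      by (intro mult_left_mono abs_ge_self) simp
    also have "\<eta> * real k = sqrt (real k)"
      using k_ge(1) by (simp add: \<eta>_sqrt real_div_sqrt)
    \<comment> \<open>The bound on sqrt k times m squared yields the rate k^(-1/4) for m through a
      second square root.\<close>
    finally have "sqrt (sqrt (real k) * m\<^sup>2) \<le> sqrt (2 * \<bar>fbar - flow + 2 * C\<bar>)"
      by (rule real_sqrt_le_mono)
    also have "sqrt (sqrt (real k) * m\<^sup>2) = real k powr (1/4) * m"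
      using k_ge(1) m_nonneg by (simp add: real_sqrt_mult powr_powr flip: powr_half_sqrt)
    also have "sqrt (2 * \<bar>fbar - flow + 2 * C\<bar>) \<le> K4 fbar" by (simp add: K4_def)
    finally show ?thesis
      unfolding m_def[symmetric] using k_ge(1) by (simp add: pos_le_divide_eq mult.commute)
  qed
  have K1: "0 < K1" using K1_terms unfolding K1_def by linarith
  have K4: "0 < K4 fbar" for fbar
    unfolding K4_def by (intro add_pos_nonneg) auto
  show ?thesis
    by (rule exI[of _ K1], rule conjI[OF K1], (rule exI[of _ 1], rule conjI[OF zero_less_one])+,
        rule allI, rule exI[of _ "K4 _"], rule conjI[OF K4]) (use main in blast)
qed

end
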